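(* Let $b\geq 2$ be an integer and let $M\in\mathcal{M}_b(\mathbf{P_1})$. Then $\sup_{n\in\mathbb{N}}\|M^n\|=2^{b-1}$ if and only if $M$ is equivalent with one of the following three $b\times b$ matrices (in block form): $$\begin{pmatrix}1&\mathbf{0}\\ \mathbf{1}&L_{b-1}\end{pmatrix},\qquad \begin{pmatrix}I_2&\mathbf{0}\\ \mathbf{1}&L_{b-2}\end{pmatrix},\qquad \begin{pmatrix}J_2&\mathbf{0}\\ \mathbf{1}&L_{b-2}\end{pmatrix}.$$ In the case $b=2$, these three matrices are $\begin{pmatrix}1&0\\1&0\end{pmatrix}$, $I_2$, $J_2$, respectively.
   Context: $\mathbb{N}$ is the set of positive integers and $A=\{1,2,\dots,b\}$. For a real matrix $M=(M_{ij})$, $\|M\|=\sum_{i,j}|M_{ij}|$. $\mathcal{M}_b$ is the family of nonzero $b\times b$ matrices with entries in $\{0,1\}$; $r_i(M)$ and $c_j(M)$ denote the $i$-th row and $j$-th column of $M$. A matrix $M\in\mathcal{M}_b$ satisfies condition $\mathbf{P_1}$ if $r_i(M)\neq\mathbf{0}$ for every $i\in\{j\in A: c_j(M)\neq\mathbf{0}\}$; $\mathcal{M}_b(\mathbf{P_1})$ is the set of all $M\in\mathcal{M}_b$ satisfying $\mathbf{P_1}$. $\mathbf{1}$ denotes a matrix (of the size dictated by the block structure) all of whose entries are $1$, and $\mathbf{0}$ a zero matrix. $L_k$ is the $k\times k$ matrix whose $(i,j)$ entry is $1$ if $i>j$ and $0$ otherwise. $I_k$ is the $k\times k$ identity matrix.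 $J_2=\begin{pmatrix}0&1\\1&0\end{pmatrix}$. Matrices $M,N\in\mathcal{M}_b$ are equivalent, written $M\sim N$, if there exist pairs $(i_1,j_1),\dots,(i_l,j_l)\in A\times A$ such that $M=P(i_l,j_l)\cdots P(i_1,j_1)\,N\,P(i_1,j_1)\cdots P(i_l,j_l)$, where $P(i,j)$ is the matrix obtained by interchanging the $i$-th and $j$-th rows of $I_b$. *)

theory Defs
  imports
    "Jordan_Normal_Form.Gauss_Jordan_Elimination"
    "HOL-Library.Extended_Real"
begin

text \<open>
  Matrices are those of \<open>Jordan_Normal_Form\<close>, with explicit dimensions and indices starting at 0:
  the index set \<open>A = {1, ..., b}\<close> is rendered as \<open>{..<b}\<close>.
\<close>

definition entry_norm :: "real mat \<Rightarrow> real" where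
  "entry_norm M = (\<Sum>i<dim_row M. \<Sum>j<dim_col M. \<bar>M $$ (i, j)\<bar>)"

definition binary_mats :: "nat \<Rightarrow> real mat set" where
  "binary_mats b = {M \<in> carrier_mat b b. M \<noteq> 0\<^sub>m b b \<and> elements_mat M \<subseteq> {0, 1}}"

definition cond_P1 :: "nat \<Rightarrow> real mat \<Rightarrow> bool" where
  "cond_P1 b M \<longleftrightarrow> (\<forall>i \<in> {j \<in> {..<b}. col M j \<noteq> 0\<^sub>v b}. row M i \<noteq> 0\<^sub>v b)"

definition binary_mats_P1 :: "nat \<Rightarrow> real mat set" where
  "binary_mats_P1 b = {M \<in> binary_mats b. cond_P1 b M}"

definition swap_mat :: "nat \<Rightarrow> nat \<Rightarrow> nat \<Rightarrow> real mat" where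
  "swap_mat b i j = swaprows i j (1\<^sub>m b)"

text \<open>For \<open>ps = [(i\<^sub>1, j\<^sub>1), ..., (i\<^sub>l, j\<^sub>l)]\<close> this is the product
  \<open>P(i\<^sub>1, j\<^sub>1) \<cdots> P(i\<^sub>l, j\<^sub>l)\<close>, read from left to right.\<close>

definition swap_prod :: "nat \<Rightarrow> (nat \<times> nat) list \<Rightarrow> real mat" where
  "swap_prod b ps = foldr (\<lambda>(i, j) Q. swap_mat b i j * Q) ps (1\<^sub>m b)"

text \<open>The empty list only contributes \<open>M = N\<close>, which is also obtained from \<open>P(i, i) = I\<^sub>b\<close>.\<close>

definition perm_equiv :: "nat \<Rightarrow> real mat \<Rightarrow> real mat \<Rightarrow> bool" where
  "perm_equiv b M N \<longleftrightarrow> M \<in> binary_mats b \<and> N \<in> binary_mats b \<and>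
     (\<exists>ps. set ps \<subseteq> {..<b} \<times> {..<b} \<and> M = swap_prod b (rev ps) * N * swap_prod b ps)"

definition ones_mat :: "nat \<Rightarrow> nat \<Rightarrow> real mat" where
  "ones_mat m n = mat m n (\<lambda>_. 1)"

definition L_mat :: "nat \<Rightarrow> real mat" where
  "L_mat k = mat k k (\<lambda>(i, j). if i > j then 1 else 0)"

definition J2 :: "real mat" where
  "J2 = mat_of_rows_list 2 [[0, 1], [1, 0]]"

text \<open>The common block shape of the three extremal matrices, with a \<open>k \<times> k\<close> upper left block.\<close>

definition lower_block :: "nat \<Rightarrow> nat \<Rightarrow> real mat \<Rightarrow> real mat" where
  "lower_block b k B = four_block_mat B (0\<^sub>m k (b - k)) (ones_mat (b - k) k) (L_mat (b - k))"

end

theory Submission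
  imports Defs "HOL-Combinatorics.Permutations"
begin

text \<open>Read \<open>M\<close> as a digraph, so that \<open>\<parallel>M^n\<parallel>\<close> counts the walks of length \<open>n\<close>. By \<open>P\<^sub>1\<close> every
  nontrivial walk can be continued, so the counts increase; if their supremum is finite, then
  the vector \<open>N\<close> of walk counts is eventually stable and satisfies \<open>M N = N\<close>.
  Induction on a successor-closed vertex set \<open>S\<close> gives \<open>2 \<Sum>\<^sub>S N \<le> 2^|S|\<close>: a vertex of \<open>S\<close> without
  predecessor in \<open>S\<close> can be removed, at most halving the sum, with exact halving only if it
  points to all the remaining vertices; if there is no such vertex, then \<open>S\<close> is a union of disjoint
  cycles and the sum is \<open>|S|\<close>, where \<open>2 |S| = 2^|S|\<close> only for \<open>|S| \<in> {1, 2}\<close>. Reinserting the removed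
  vertices one by one yields the three block matrices.\<close>

section \<open>Walk counts and the shape of the extremal graphs\<close>

fun walk_count :: "('a \<Rightarrow> 'a set) \<Rightarrow> nat \<Rightarrow> 'a \<Rightarrow> nat" where
  "walk_count E 0 v = 1"
| "walk_count E (Suc n) v = (\<Sum>u\<in>E v. walk_count E n u)"

text \<open>In all three extremal matrices the first two rows have a single 1 in one of the first two
  columns; \<open>block_rows\<close> lists its possible positions, and \<open>row_succ\<close> gives the support of each row.\<close>

definition block_rows :: "(nat \<Rightarrow> nat) set" where
  "block_rows = {\<lambda>_. 0, id, \<lambda>i. 1 - i}"

definition row_succ :: "(nat \<Rightarrow> nat) \<Rightarrow> nat \<Rightarrow> nat set" where
  "row_succ s i = (if i < 2 then {s i} else {..<i})"

text \<open>For a singleton, \<open>\<lambda>_. 0\<close> and \<open>id\<close> describe the same graph, but only the former still does so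
  after appending a vertex.\<close>

definition extremal_order :: "('a \<Rightarrow> 'a set) \<Rightarrow> 'a set \<Rightarrow> (nat \<Rightarrow> nat) \<Rightarrow> (nat \<Rightarrow> 'a) \<Rightarrow> bool" where
  "extremal_order E S s p \<longleftrightarrow> s \<in> block_rows \<and> (card S < 2 \<longrightarrow> s = (\<lambda>_. 0)) \<and>
     bij_betw p {..<card S} S \<and> (\<forall>i<card S. E (p i) = p ` row_succ s i)"

lemma double_less_power2: "3 \<le> n \<Longrightarrow> 2 * n < (2::nat) ^ n"
proof (induction n rule: dec_induct)
  case (step n)
  then have "2 * n < 2 ^ n" "2 \<le> n" by auto
  then show ?case by simp
qed simp

locale P1_graph =
  fixes V :: "'a set" and E :: "'a \<Rightarrow> 'a set"
  assumes finite_V: "finite V"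
    and closed_V: "v \<in> V \<Longrightarrow> E v \<subseteq> V"
    and succ_nonempty: "v \<in> V \<Longrightarrow> u \<in> E v \<Longrightarrow> E u \<noteq> {}"
begin

lemma finite_succ: "v \<in> V \<Longrightarrow> finite (E v)"
  using closed_V finite_V finite_subset by blast

text \<open>A walk of positive length ends in a vertex that has a predecessor, hence a successor, so
  it can be prolonged. Length 0 must be left out: a sink has one walk of length 0 and none of length
  1.\<close>

lemma walk_count_mono:
  "v \<in> V \<Longrightarrow> walk_count E (Suc n) v \<le> walk_count E (Suc (Suc n)) v"
proof (induction n arbitrary: v)
  case 0
  have "(\<Sum>u\<in>E v. 1) \<le> (\<Sum>u\<in>E v. card (E u))"
  proof (rule sum_mono)
    fix u assume u: "u \<in> E v"
    then have "u \<in> V" "E u \<noteq> {}" using closed_V succ_nonempty 0 by auto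
    then show "1 \<le> card (E u)" using finite_succ[of u] by (simp add: Suc_le_eq card_gt_0_iff)
  qed
  then show ?case by simp
next
  case (Suc n)
  have "(\<Sum>u\<in>E v. walk_count E (Suc n) u) \<le> (\<Sum>u\<in>E v. walk_count E (Suc (Suc n)) u)"
    using closed_V[OF Suc.prems] by (intro sum_mono Suc.IH) auto
  then show ?case
    unfolding walk_count.simps(2)[of E "Suc n" v] walk_count.simps(2)[of E "Suc (Suc n)" v] .
qed

lemma walk_count_pos:
  assumes v: "v \<in> V" "E v \<noteq> {}"
  shows "0 < walk_count E n v"
proof (induction n)
  case (Suc n)
  show ?case
  proof (cases n)
    case 0
    then show ?thesis using v finite_succ[of v] by (simp add: card_gt_0_iff)
  next
    case (Suc k)
    then show ?thesis using Suc.IH walk_count_mono[OF v(1), of k]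
      by (simp del: walk_count.simps)
  qed
qed simp

end

section \<open>Graphs with stable walk counts: the bound and its equality case\<close>

text \<open>Stability at the single length \<open>n\<close> says that the vector of counts is fixed
  by the adjacency matrix. In particular a sink has count 0.\<close>

locale stable_walks = P1_graph +
  fixes n :: nat
  assumes stable: "v \<in> V \<Longrightarrow> walk_count E (Suc n) v = walk_count E n v"
begin

abbreviation N where "N \<equiv> walk_count E n"

lemmas pos = walk_count_pos[where n = n]

text \<open>If every vertex of a closed set has a predecessor in it, then weighting the edges by the
  invariant vector shows that all in-degrees are one, so that the walks ending in distinct
  vertices continue to be in bijection with the vertices.\<close>

lemma indegree_one:
  assumes S: "S \<subseteq> V" "\<forall>v\<in>S. E v \<subseteq> S" "\<forall>u\<in>S. \<exists>v\<in>S. u \<in> E v" and u: "u \<in> S"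
  shows "card {v \<in> S. u \<in> E v} = 1"
proof -
  have fin: "finite S" using S finite_V finite_subset by blast
  have "(\<Sum>v\<in>S. N v) = (\<Sum>v\<in>S. \<Sum>u\<in>{u \<in> S. u \<in> E v}. N u)"
  proof (rule sum.cong)
    fix v assume v: "v \<in> S"
    then have "{u \<in> S. u \<in> E v} = E v" using S by blast
    then show "N v = (\<Sum>u\<in>{u \<in> S. u \<in> E v}. N u)" using stable[of v] v S by auto
  qed simp
  also have "\<dots> = (\<Sum>u\<in>S. \<Sum>v\<in>{v \<in> S. u \<in> E v}. N u)"
    by (rule sum.swap_restrict[OF fin fin])
  finally have eq: "(\<Sum>u\<in>S. N u) = (\<Sum>u\<in>S. card {v \<in> S. u \<in> E v} * N u)" by simp
  \<comment> \<open>Every in-degree is at least 1, so the equality of the two sums holds term by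
    term; the positive count can then be cancelled.\<close>
  have "1 \<le> card {v \<in> S. u \<in> E v}" if "u \<in> S" for u
    using S(3) that fin by (auto simp: Suc_le_eq card_gt_0_iff)
  then have "N u = card {v \<in> S. u \<in> E v} * N u"
    by (intro sum_mono_inv[OF eq _ u fin]) simp
  moreover have "0 < N u"
    using S u pos[of u] succ_nonempty[of _ u] by blast
  ultimately show ?thesis by simp
qed

text \<open>With all in-degrees equal to 1, removing the first edge preserves the total count, so it
  keeps its value at length 0. Stability is given at \<open>n\<close> only, hence the induction over
  a separate length \<open>k\<close>.\<close>

lemma sum_walks_card:
  assumes S: "S \<subseteq> V" "\<forall>v\<in>S. E v \<subseteq> S" "\<forall>u\<in>S. \<exists>v\<in>S. u \<in> E v"
  shows "(\<Sum>v\<in>S. walk_count E k v) = card S"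
proof (induction k)
  case (Suc k)
  have fin: "finite S" using S finite_V finite_subset by blast
  have "(\<Sum>v\<in>S. walk_count E (Suc k) v) = (\<Sum>v\<in>S. \<Sum>u\<in>{u \<in> S. u \<in> E v}. walk_count E k u)"
  proof (rule sum.cong)
    fix v assume v: "v \<in> S"
    then have "{u \<in> S. u \<in> E v} = E v" using S by blast
    then show "walk_count E (Suc k) v = (\<Sum>u\<in>{u \<in> S. u \<in> E v}. walk_count E k u)" by simp
  qed simp
  also have "\<dots> = (\<Sum>u\<in>S. \<Sum>v\<in>{v \<in> S. u \<in> E v}. walk_count E k u)"
    by (rule sum.swap_restrict[OF fin fin])
  also have "\<dots> = (\<Sum>u\<in>S. walk_count E k u)"
    by (intro sum.cong) (simp_all add: indegree_one[OF S])
  finally show ?case using Suc by simp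
qed simp

text \<open>In-degree one leaves a loop, two loops or a 2-cycle: the upper left blocks 1, I_2 and
  J_2.\<close>

lemma extremal_order_cyclic:
  assumes S: "S \<subseteq> V" "\<forall>v\<in>S. E v \<subseteq> S" "\<forall>u\<in>S. \<exists>v\<in>S. u \<in> E v"
    and card: "card S = 1 \<or> card S = 2"
  shows "\<exists>s p. extremal_order E S s p"
proof -
  have ne: "E u \<noteq> {}" if "u \<in> S" for u
    using that S succ_nonempty[of _ u] by blast
  note one = indegree_one[OF S]
  from card show ?thesis
  proof
    assume "card S = 1"
    then obtain x where x: "S = {x}" by (auto simp: card_1_singleton_iff)
    then have "E x = {x}" using ne S by blast
    then have "extremal_order E S (\<lambda>_. 0) (\<lambda>_. x)"
      by (simp add: extremal_order_def block_rows_def row_succ_def x bij_betw_def lessThan_Suc)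
    then show ?thesis by blast
  next
    assume c2: "card S = 2"
    then obtain x y where xy: "S = {x, y}" "x \<noteq> y" by (auto simp: card_2_iff)
    have sub: "E x \<subseteq> {x, y}" "E y \<subseteq> {x, y}" "E x \<noteq> {}" "E y \<noteq> {}" using S ne xy by auto
    \<comment> \<open>A common successor of \<open>x\<close> and \<open>y\<close> would have
      in-degree 2.\<close>
    have nb: "\<not> (u \<in> E x \<and> u \<in> E y)" if "u \<in> S" for u
    proof
      assume "u \<in> E x \<and> u \<in> E y"
      then have "{v \<in> S. u \<in> E v} = S" using xy by auto
      then show False using one[OF that] c2 by simp
    qed
    let ?p = "\<lambda>i::nat. if i = 0 then x else y"
    have bij: "bij_betw ?p {..<2} S"
      using xy by (auto simp: bij_betw_def inj_on_def image_def less_2_cases_iff)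
    have "(E x = {x} \<and> E y = {y}) \<or> (E x = {y} \<and> E y = {x})"
      using sub nb[of x] nb[of y] xy by auto
    then show ?thesis
    proof
      assume "E x = {x} \<and> E y = {y}"
      then have "extremal_order E S id ?p"
        using bij by (auto simp: extremal_order_def block_rows_def row_succ_def c2 less_2_cases_iff)
      then show ?thesis by blast
    next
      assume "E x = {y} \<and> E y = {x}"
      then have "extremal_order E S (\<lambda>i. 1 - i) ?p"
        using bij by (auto simp: extremal_order_def block_rows_def row_succ_def c2 less_2_cases_iff)
      then show ?thesis by blast
    qed
  qed
qed

text \<open>The new vertex goes last: pointing to all earlier ones, it becomes a bottom row with
  ones exactly to the left of the diagonal.\<close>

lemma extremal_order_insert:
  assumes ord: "extremal_order E T s p" and T: "finite T" "T \<noteq> {}" and v: "v \<notin> T" "E v = T"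
  shows "\<exists>s p. extremal_order E (insert v T) s p"
proof -
  let ?m = "card T"
  let ?q = "p(?m := v)"
  have p: "bij_betw p {..<?m} T" and s: "s \<in> block_rows" "?m < 2 \<longrightarrow> s = (\<lambda>_. 0)"
    and E: "\<And>i. i < ?m \<Longrightarrow> E (p i) = p ` row_succ s i"
    using ord by (auto simp: extremal_order_def)
  have m: "0 < ?m" using T by (simp add: card_gt_0_iff)
  have sub: "row_succ s i \<subseteq> {..<?m}" if "i < ?m" for i
  proof (cases "?m < 2")
    case True
    then show ?thesis using that m s by (auto simp: row_succ_def)
  next
    case False
    then show ?thesis using that s by (auto simp: row_succ_def block_rows_def)
  qed
  \<comment> \<open>For \<open>?m = 1\<close> the new row is still governed by \<open>s\<close>; it
    is {0} because \<open>s\<close> is then constantly 0. With \<open>id\<close> it would be a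
    loop.\<close>
  have last: "row_succ s ?m = {..<?m}"
    using s m by (auto simp: row_succ_def less_2_cases_iff)
  have img: "?q ` A = p ` A" if "A \<subseteq> {..<?m}" for A
    using that by (intro image_cong) auto
  have "bij_betw ?q {..<?m} T"
    using p by (subst bij_betw_cong[of _ _ p]) auto
  then have "bij_betw ?q (insert ?m {..<?m}) (insert v T)"
    using v by (auto simp: bij_betw_def)
  moreover have "E (?q i) = ?q ` row_succ s i" if "i < Suc ?m" for i
  proof (cases "i = ?m")
    case True
    then show ?thesis using img[of "{..<?m}"] last p v by (simp add: bij_betw_def)
  next
    case False
    then show ?thesis using that E[of i] img[OF sub[of i]] by simp
  qed
  ultimately have "extremal_order E (insert v T) s ?q"
    using T v m s by (simp add: extremal_order_def lessThan_Suc)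
  then show ?thesis by blast
qed

text \<open>The equality case also carries positivity of all counts, which makes a missing edge cost
  something strictly when the next vertex is added. The factor 2 replaces the exponent |S| - 1, so
  that the empty set fits in, with 0 < 1.\<close>

lemma extremal_bound:
  assumes "S \<subseteq> V" "\<forall>v\<in>S. E v \<subseteq> S"
  shows "2 * (\<Sum>v\<in>S. N v) \<le> 2 ^ card S \<and>
    (2 * (\<Sum>v\<in>S. N v) = 2 ^ card S \<longrightarrow> (\<forall>v\<in>S. 0 < N v) \<and> (\<exists>s p. extremal_order E S s p))"
  using assms
proof (induction "card S" arbitrary: S rule: less_induct)
  case less
  have fin: "finite S" using less.prems finite_V finite_subset by blast
  show ?case
  proof (cases "\<forall>u\<in>S. \<exists>v\<in>S. u \<in> E v")
    case True
    have sum: "(\<Sum>v\<in>S. N v) = card S"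
      by (rule sum_walks_card[OF less.prems True])
    have Npos: "\<forall>v\<in>S. 0 < N v"
    proof
      fix u assume "u \<in> S"
      then show "0 < N u" using True less.prems pos[of u] succ_nonempty[of _ u] by blast
    qed
    consider "card S = 0" | "card S = 1" | "card S = 2" | "3 \<le> card S" by linarith
    then show ?thesis
    proof cases
      case 4
      then show ?thesis using sum double_less_power2[of "card S"] by simp
    qed (use sum Npos extremal_order_cyclic[OF less.prems True] in simp_all)
  next
    case False
    \<comment> \<open>No vertex of \<open>S\<close>, not even \<open>v\<close> itself, points to
      \<open>v\<close>. So \<open>E v\<close> lies in the rest, and the rest is still
      closed.\<close>
    then obtain v where v: "v \<in> S" "\<And>u. u \<in> S \<Longrightarrow> v \<notin> E u" by blast
    let ?T = "S - {v}"
    have S: "S = insert v ?T" "finite ?T" "v \<notin> ?T" using v fin by auto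
    have cS: "card S = Suc (card ?T)" using S by (metis card_insert_disjoint)
    have Ev: "E v \<subseteq> ?T" using v less.prems by blast
    have T: "card ?T < card S" "?T \<subseteq> V" "\<forall>u\<in>?T. E u \<subseteq> ?T"
      using less.prems v cS by auto
    have IH: "2 * (\<Sum>v\<in>?T. N v) \<le> 2 ^ card ?T"
      "2 * (\<Sum>v\<in>?T. N v) = 2 ^ card ?T \<Longrightarrow> (\<forall>v\<in>?T. 0 < N v) \<and> (\<exists>s p. extremal_order E ?T s p)"
      using less.hyps[of ?T] T by simp_all
    have Nv: "N v = (\<Sum>u\<in>E v. N u)" using stable[of v] v less.prems by auto
    also have "\<dots> \<le> (\<Sum>u\<in>?T. N u)" using Ev S by (intro sum_mono2) auto
    finally have le: "N v \<le> (\<Sum>u\<in>?T. N u)" .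
    have sum: "(\<Sum>u\<in>S. N u) = N v + (\<Sum>u\<in>?T. N u)" using S by (metis sum.insert)
    have pow: "(2::nat) ^ card S = 2 * 2 ^ card ?T" using cS by simp
    have "2 * (\<Sum>v\<in>S. N v) \<le> 2 ^ card S" using le sum IH(1) pow by linarith
    moreover have "(\<forall>v\<in>S. 0 < N v) \<and> (\<exists>s p. extremal_order E S s p)"
      if eq: "2 * (\<Sum>v\<in>S. N v) = 2 ^ card S"
    proof -
      \<comment> \<open>Equality for \<open>S\<close> forces equality both in the induction
        hypothesis and in the comparison of \<open>N v\<close> with the sum over the rest.\<close>
      have eqT: "2 * (\<Sum>v\<in>?T. N v) = 2 ^ card ?T" and NvT: "N v = (\<Sum>u\<in>?T. N u)"
        using eq le sum IH(1) pow by linarith+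
      note T' = IH(2)[OF eqT]
      \<comment> \<open>An empty rest would give 2 * 0 = 2^0.\<close>
      have "0 < (2::nat) ^ card ?T" by simp
      then have Tpos: "0 < (\<Sum>u\<in>?T. N u)" using eqT by linarith
      then have ne: "?T \<noteq> {}" by (metis sum.empty less_irrefl)
      have "E v = ?T"
      proof (rule ccontr)
        assume "E v \<noteq> ?T"
        then obtain w where w: "w \<in> ?T" "w \<notin> E v" using Ev by blast
        have "(\<Sum>u\<in>E v. N u) < (\<Sum>u\<in>?T. N u)"
          using T' w by (intro sum_strict_mono2[OF S(2) Ev, of w]) auto
        then show False using Nv NvT by simp
      qed
      then have "\<exists>s p. extremal_order E (insert v ?T) s p"
        using T' ne S extremal_order_insert by blast
      then show ?thesis using T' Tpos NvT S(1) by auto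
    qed
    ultimately show ?thesis by blast
  qed
qed

end

section \<open>Walk counts of the extremal graphs\<close>

text \<open>On \<open>I\<close>, \<open>p\<close> is an isomorphism of graphs onto its image, and
  \<open>I\<close> is closed under successors, so walks correspond.\<close>

lemma walk_count_cong:
  assumes "\<And>i. i \<in> I \<Longrightarrow> F i \<subseteq> I" "inj_on p I" "\<And>i. i \<in> I \<Longrightarrow> E (p i) = p ` F i" "i \<in> I"
  shows "walk_count E n (p i) = walk_count F n i"
  using assms(4)
proof (induction n arbitrary: i)
  case (Suc n)
  have "inj_on p (F i)" using assms Suc by (metis inj_on_subset)
  then have "walk_count E (Suc n) (p i) = (\<Sum>j\<in>F i. walk_count E n (p j))"
    using assms Suc by (simp add: sum.reindex)
  also have "\<dots> = walk_count F (Suc n) i"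
    unfolding walk_count.simps using assms(1)[OF Suc.prems] Suc.IH by (intro sum.cong) blast+
  finally show ?case .
qed simp

text \<open>Truncated subtraction gives the indices 0 and 1 the same weight 1; from then on each
  term equals the sum of all before it. This serves both as the recursion for a row and as the final
  total.\<close>

lemma sum_power2_pred: "0 < b \<Longrightarrow> (\<Sum>i<b. (2::nat) ^ (i - 1)) = 2 ^ (b - 1)"
proof (induction b rule: nat_induct_non_zero)
  case (Suc n)
  have "(2::nat) ^ n = 2 * 2 ^ (n - 1)" using Suc by (metis power_eq_if neq0_conv)
  then show ?case using Suc by simp
qed simp

text \<open>From row 2 on, a count is the sum of the counts of all earlier rows one step before, so
  the powers of 2 reproduce themselves. Row \<open>i\<close> has reached its limit by length
  \<open>i\<close>.\<close>

lemma walk_count_row_succ: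
  assumes "s \<in> block_rows"
  shows "walk_count (row_succ s) n i \<le> 2 ^ (i - 1)"
    and "i \<le> n \<Longrightarrow> walk_count (row_succ s) n i = 2 ^ (i - 1)"
proof -
  \<comment> \<open>The first two vertices have one successor each, again among the first two, so
    exactly one walk of each length starts there.\<close>
  have block: "walk_count (row_succ s) n i = 1" if "i < 2" for n i
    using that
  proof (induction n arbitrary: i)
    case (Suc n)
    have "s i < 2" using Suc.prems assms by (auto simp: block_rows_def)
    then show ?case using Suc by (simp add: row_succ_def)
  qed simp
  show "walk_count (row_succ s) n i \<le> 2 ^ (i - 1)"
  proof (induction n arbitrary: i)
    case (Suc n)
    show ?case
    proof (cases "i < 2")
      case True
      then show ?thesis using block[OF True, of "Suc n"] by (simp del: walk_count.simps)
    next
      case False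
      then have "walk_count (row_succ s) (Suc n) i = (\<Sum>j<i. walk_count (row_succ s) n j)"
        by (simp add: row_succ_def)
      also have "\<dots> \<le> (\<Sum>j<i. 2 ^ (j - 1))" by (intro sum_mono Suc)
      finally show ?thesis using False sum_power2_pred[of i] by simp
    qed
  qed simp
  show "walk_count (row_succ s) n i = 2 ^ (i - 1)" if "i \<le> n"
    using that
  proof (induction n arbitrary: i)
    case (Suc n)
    show ?case
    proof (cases "i < 2")
      case True
      then have "i - 1 = 0" by simp
      then show ?thesis using block[OF True, of "Suc n"] by (simp del: walk_count.simps)
    next
      case False
      then have "walk_count (row_succ s) (Suc n) i = (\<Sum>j<i. walk_count (row_succ s) n j)"
        by (simp add: row_succ_def)
      also have "\<dots> = (\<Sum>j<i. 2 ^ (j - 1))" using Suc by (intro sum.cong) auto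
      finally show ?thesis using False sum_power2_pred[of i] by simp
    qed
  qed simp
qed

section \<open>Equivalence as a simultaneous permutation of rows and columns\<close>

lemma swap_mat_carrier [simp]: "swap_mat b i j \<in> carrier_mat b b"
  by (simp add: swap_mat_def)

lemma swap_mat_dim [simp]: "dim_row (swap_mat b i j) = b" "dim_col (swap_mat b i j) = b"
  by (simp_all add: swap_mat_def)

lemma swap_mat_index:
  assumes "i < b" "j < b" "k < b" "l < b"
  shows "swap_mat b i j $$ (k, l) = (if l = transpose i j k then 1 else 0)"
  using assms by (auto simp: swap_mat_def transpose_def)

lemma transpose_less: "i < b \<Longrightarrow> j < b \<Longrightarrow> k < b \<Longrightarrow> transpose i j k < (b::nat)"
  by (simp add: transpose_def)

lemma mat_mult_index:
  assumes "A \<in> carrier_mat b b" "B \<in> carrier_mat b b" "k < b" "l < b"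
  shows "(A * B) $$ (k, l) = (\<Sum>q<b. A $$ (k, q) * B $$ (q, l))"
  using assms by (simp add: scalar_prod_def atLeast0LessThan)

lemma swap_conj_index:
  assumes N: "N \<in> carrier_mat b b" and ij: "i < b" "j < b" and kl: "k < b" "l < b"
  shows "(swap_mat b i j * N * swap_mat b i j) $$ (k, l) = N $$ (transpose i j k, transpose i j l)"
proof -
  let ?P = "swap_mat b i j"
  have left: "(?P * N) $$ (k, m) = N $$ (transpose i j k, m)" if m: "m < b" for m
  proof -
    have "(?P * N) $$ (k, m) = (\<Sum>q<b. ?P $$ (k, q) * N $$ (q, m))"
      using N kl m by (intro mat_mult_index) simp_all
    also have "\<dots> = (\<Sum>q<b. if q = transpose i j k then N $$ (q, m) else 0)"
      using ij kl by (intro sum.cong) (auto simp: swap_mat_index)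
    also have "\<dots> = N $$ (transpose i j k, m)"
      using transpose_less[OF ij kl(1)] by simp
    finally show ?thesis .
  qed
  have "(?P * N * ?P) $$ (k, l) = (\<Sum>q<b. (?P * N) $$ (k, q) * ?P $$ (q, l))"
    using kl mult_carrier_mat[OF swap_mat_carrier N] by (intro mat_mult_index) simp_all
  also have "\<dots> = (\<Sum>q<b. if q = transpose i j l then N $$ (transpose i j k, q) else 0)"
    using ij kl left by (intro sum.cong) (auto simp: swap_mat_index)
  also have "\<dots> = N $$ (transpose i j k, transpose i j l)"
    using transpose_less[OF ij kl(2)] by simp
  finally show ?thesis .
qed

lemma swap_prod_carrier [simp]: "swap_prod b ps \<in> carrier_mat b b"
  by (induction ps) (auto simp: swap_prod_def)

lemma swap_prod_Cons: "swap_prod b ((i, j) # ps) = swap_mat b i j * swap_prod b ps"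
  by (simp add: swap_prod_def)

lemma swap_prod_append: "swap_prod b (ps @ qs) = swap_prod b ps * swap_prod b qs"
proof (induction ps)
  case Nil
  then show ?case using swap_prod_carrier[of b qs] by (simp add: swap_prod_def)
next
  case (Cons x ps)
  then show ?case
    by (cases x) (simp add: swap_prod_Cons assoc_mult_mat[of _ b b _ b _ b])
qed

text \<open>Swaps are involutions, so for indices below \<open>b\<close> the reversed product is the
  inverse of the product, and this is a conjugation.\<close>

abbreviation swap_conj :: "nat \<Rightarrow> (nat \<times> nat) list \<Rightarrow> real mat \<Rightarrow> real mat" where
  "swap_conj b ps N \<equiv> swap_prod b (rev ps) * N * swap_prod b ps"

lemma swap_conj_Nil: "N \<in> carrier_mat b b \<Longrightarrow> swap_prod b [] * N * swap_prod b [] = N"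
  by (simp add: swap_prod_def)

text \<open>The head of the list acts innermost, that is first, so inductions on the list have to
  vary \<open>N\<close>.\<close>

lemma swap_conj_Cons:
  assumes N: "N \<in> carrier_mat b b"
  shows "swap_conj b ((i, j) # ps) N = swap_conj b ps (swap_mat b i j * N * swap_mat b i j)"
proof -
  let ?P = "swap_mat b i j" and ?A = "swap_prod b (rev ps)" and ?B = "swap_prod b ps"
  have "swap_prod b [(i, j)] = ?P"
    using swap_mat_carrier[of b i j] by (simp add: swap_prod_def)
  then have "swap_conj b ((i, j) # ps) N = (?A * ?P) * N * (?P * ?B)"
    by (simp add: swap_prod_append swap_prod_Cons)
  also have "\<dots> = ?A * (?P * N * ?P) * ?B"
  proof -
    have 1: "(?A * ?P) * N = ?A * (?P * N)"
      by (rule assoc_mult_mat[of _ b b _ b _ b]) (use N in simp_all)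
    have 2: "?A * (?P * N) * (?P * ?B) = ?A * (?P * N) * ?P * ?B"
      by (rule assoc_mult_mat[of _ b b _ b _ b, symmetric])
        (simp_all add: mult_carrier_mat[OF swap_prod_carrier mult_carrier_mat[OF swap_mat_carrier N]])
    have 3: "?A * (?P * N) * ?P = ?A * (?P * N * ?P)"
      by (rule assoc_mult_mat[of _ b b _ b _ b]) (use mult_carrier_mat[OF swap_mat_carrier N] in simp_all)
    show ?thesis unfolding 1 2 3 ..
  qed
  finally show ?thesis .
qed

text \<open>Each swap relabels rows and columns by the same transposition. As the head acts first,
  its transposition is composed on the right.\<close>

lemma swap_conj_permutes:
  assumes "N \<in> carrier_mat b b" "set ps \<subseteq> {..<b} \<times> {..<b}"
  shows "\<exists>p. p permutes {..<b} \<and> (\<forall>i<b. \<forall>j<b. swap_conj b ps N $$ (p i, p j) = N $$ (i, j))"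
  using assms
proof (induction ps arbitrary: N)
  case Nil
  have "id permutes {..<b} \<and> (\<forall>i<b. \<forall>j<b. swap_conj b [] N $$ (id i, id j) = N $$ (i, j))"
    using swap_conj_Nil[OF Nil(1)] permutes_id by auto
  then show ?case by blast
next
  case (Cons x ps)
  obtain k l where x: "x = (k, l)" by (cases x)
  have kl: "k < b" "l < b" using Cons.prems x by auto
  let ?N = "swap_mat b k l * N * swap_mat b k l"
  have "?N \<in> carrier_mat b b" using Cons.prems by (meson mult_carrier_mat swap_mat_carrier)
  then obtain p where p: "p permutes {..<b}"
    and eq: "\<And>i j. i < b \<Longrightarrow> j < b \<Longrightarrow> swap_conj b ps ?N $$ (p i, p j) = ?N $$ (i, j)"
    using Cons.IH[of ?N] Cons.prems by auto
  have "p \<circ> transpose k l permutes {..<b}"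
    using p kl by (intro permutes_compose permutes_swap_id) auto
  moreover have "swap_conj b (x # ps) N $$ ((p \<circ> transpose k l) i, (p \<circ> transpose k l) j) = N $$ (i, j)"
    if "i < b" "j < b" for i j
    using eq[OF transpose_less[OF kl that(1)] transpose_less[OF kl that(2)]]
      swap_conj_index[OF Cons.prems(1) kl transpose_less[OF kl that(1)] transpose_less[OF kl that(2)]]
    unfolding x swap_conj_Cons[OF Cons.prems(1)] by simp
  ultimately show ?case by blast
qed

text \<open>A permutation of a finite set is a product of transpositions;
  \<open>permutes_rev_induct\<close> splits them off on the right, in the order in which
  \<open>swap_conj_Cons\<close> consumes the list.\<close>

lemma permutes_swap_conj:
  assumes "p permutes {..<b}" "N \<in> carrier_mat b b"
  shows "\<exists>ps. set ps \<subseteq> {..<b} \<times> {..<b} \<and>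
    (\<forall>i<b. \<forall>j<b. swap_conj b ps N $$ (p i, p j) = N $$ (i, j))"
proof -
  have "\<forall>N\<in>carrier_mat b b. \<exists>ps. set ps \<subseteq> {..<b} \<times> {..<b} \<and>
    (\<forall>i<b. \<forall>j<b. swap_conj b ps N $$ (p i, p j) = N $$ (i, j))"
    using finite_lessThan assms(1)
  proof (induction p rule: permutes_rev_induct)
    case id
    then show ?case by (intro ballI exI[of _ "[]"]) (simp add: swap_conj_Nil)
  next
    case (swap k l p)
    show ?case
    proof
      fix N :: "real mat" assume N: "N \<in> carrier_mat b b"
      have kl: "k < b" "l < b" using swap by auto
      let ?N = "swap_mat b k l * N * swap_mat b k l"
      have "?N \<in> carrier_mat b b" using N by (meson mult_carrier_mat swap_mat_carrier)
      from bspec[OF swap.IH this] obtain ps where ps: "set ps \<subseteq> {..<b} \<times> {..<b}"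
        and eq: "\<And>i j. i < b \<Longrightarrow> j < b \<Longrightarrow> swap_conj b ps ?N $$ (p i, p j) = ?N $$ (i, j)"
        by (elim exE conjE) simp
      have "swap_conj b ((k, l) # ps) N $$ ((p \<circ> transpose k l) i, (p \<circ> transpose k l) j) = N $$ (i, j)"
        if "i < b" "j < b" for i j
        using eq[OF transpose_less[OF kl that(1)] transpose_less[OF kl that(2)]]
          swap_conj_index[OF N kl transpose_less[OF kl that(1)] transpose_less[OF kl that(2)]]
        unfolding swap_conj_Cons[OF N] by simp
      moreover have "set ((k, l) # ps) \<subseteq> {..<b} \<times> {..<b}" using ps kl by auto
      ultimately show "\<exists>ps. set ps \<subseteq> {..<b} \<times> {..<b} \<and> (\<forall>i<b. \<forall>j<b.
          swap_conj b ps N $$ ((p \<circ> transpose k l) i, (p \<circ> transpose k l) j) = N $$ (i, j))"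
        by blast
    qed
  qed
  then show ?thesis using assms(2) by blast
qed

lemma binary_mats_carrier: "M \<in> binary_mats b \<Longrightarrow> M \<in> carrier_mat b b"
  by (simp add: binary_mats_def)

lemma binary_mats_index:
  assumes "M \<in> binary_mats b" "i < b" "j < b"
  shows "M $$ (i, j) = 0 \<or> M $$ (i, j) = 1"
proof -
  have "M $$ (i, j) \<in> elements_mat M"
    using assms by (intro elements_matI) (auto simp: binary_mats_def)
  then show ?thesis using assms by (auto simp: binary_mats_def)
qed

lemma perm_equiv_iff:
  assumes M: "M \<in> binary_mats b" and N: "N \<in> carrier_mat b b"
  shows "perm_equiv b M N \<longleftrightarrow>
    (\<exists>p. p permutes {..<b} \<and> (\<forall>i<b. \<forall>j<b. M $$ (p i, p j) = N $$ (i, j)))"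
proof
  assume "perm_equiv b M N"
  then show "\<exists>p. p permutes {..<b} \<and> (\<forall>i<b. \<forall>j<b. M $$ (p i, p j) = N $$ (i, j))"
    using swap_conj_permutes[OF N] unfolding perm_equiv_def by blast
next
  assume "\<exists>p. p permutes {..<b} \<and> (\<forall>i<b. \<forall>j<b. M $$ (p i, p j) = N $$ (i, j))"
  then obtain p where p: "p permutes {..<b}"
    and eq: "\<And>i j. i < b \<Longrightarrow> j < b \<Longrightarrow> M $$ (p i, p j) = N $$ (i, j)" by blast
  have less: "p i < b" if "i < b" for i using that permutes_in_image[OF p, of i] by simp
  have inv: "\<exists>k<b. i = p k" if "i < b" for i
    using that permutes_image[OF p] by (metis imageE lessThan_iff)
  note Mc = binary_mats_carrier[OF M]
  obtain ps where ps: "set ps \<subseteq> {..<b} \<times> {..<b}"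
    and ps_eq: "\<And>i j. i < b \<Longrightarrow> j < b \<Longrightarrow> swap_conj b ps N $$ (p i, p j) = N $$ (i, j)"
    using permutes_swap_conj[OF p N] by blast
  have c: "swap_conj b ps N \<in> carrier_mat b b"
    using N by (meson mult_carrier_mat swap_prod_carrier)
  have "M = swap_conj b ps N"
  proof (rule eq_matI)
    fix i j assume "i < dim_row (swap_conj b ps N)" "j < dim_col (swap_conj b ps N)"
    then have "i < b" "j < b" using c by auto
    then obtain k l where kl: "k < b" "l < b" and ij: "i = p k" "j = p l"
      using inv[of i] inv[of j] by blast
    show "M $$ (i, j) = swap_conj b ps N $$ (i, j)"
      unfolding ij eq[OF kl] ps_eq[OF kl] ..
  qed (use Mc c in auto)
  \<comment> \<open>\<open>perm_equiv\<close> also asks for \<open>N\<close> to be binary and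
    nonzero; both properties carry over from \<open>M\<close> along \<open>p\<close>.\<close>
  moreover have "N \<in> binary_mats b"
  proof -
    have "elements_mat N \<subseteq> {0, 1}"
    proof
      fix x assume "x \<in> elements_mat N"
      then obtain i j where "i < b" "j < b" "x = N $$ (i, j)"
        using N by (auto simp: elements_mat_def)
      then show "x \<in> {0, 1}"
        using eq[of i j] binary_mats_index[OF M less less, of i j] by auto
    qed
    moreover have "N \<noteq> 0\<^sub>m b b"
    proof
      assume N0: "N = 0\<^sub>m b b"
      have "M = 0\<^sub>m b b"
      proof (rule eq_matI)
        fix i j assume "i < dim_row (0\<^sub>m b b :: real mat)" "j < dim_col (0\<^sub>m b b :: real mat)"
        then have "i < b" "j < b" by auto
        then obtain k l where kl: "k < b" "l < b" and ij: "i = p k" "j = p l"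
          using inv[of i] inv[of j] by blast
        show "M $$ (i, j) = 0\<^sub>m b b $$ (i, j)"
          unfolding ij eq[OF kl] N0 using kl less[of k] less[of l] by simp
      qed (use Mc in auto)
      then show False using M by (simp add: binary_mats_def)
    qed
    ultimately show ?thesis using N by (simp add: binary_mats_def)
  qed
  ultimately show "perm_equiv b M N"
    using M ps unfolding perm_equiv_def by blast
qed

section \<open>Matrix powers as walk counts\<close>

definition mat_succ :: "nat \<Rightarrow> real mat \<Rightarrow> nat \<Rightarrow> nat set" where
  "mat_succ b M v = {u. u < b \<and> M $$ (v, u) = 1}"

text \<open>\<open>pow_mat\<close> adds its new factor on the right, whereas
  \<open>walk_count\<close> removes the first edge of a walk.\<close>

lemma pow_mat_Suc_left:
  assumes "(M :: real mat) \<in> carrier_mat b b"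
  shows "M ^\<^sub>m Suc n = M * M ^\<^sub>m n"
proof (induction n)
  case (Suc n)
  have "M ^\<^sub>m Suc (Suc n) = (M * M ^\<^sub>m n) * M" using Suc by simp
  also have "\<dots> = M * (M ^\<^sub>m n * M)"
    using assms by (intro assoc_mult_mat[of _ b b _ b _ b]) auto
  finally show ?case by simp
qed (use assms in simp)

text \<open>Row sums of the powers count the walks from a vertex; nonnegativity removes the absolute
  values from \<open>entry_norm\<close>.\<close>

lemma pow_mat_walks:
  assumes M: "M \<in> binary_mats b" and i: "i < b"
  shows "\<forall>j<b. 0 \<le> (M ^\<^sub>m n) $$ (i, j)"
    and "(\<Sum>j<b. (M ^\<^sub>m n) $$ (i, j)) = real (walk_count (mat_succ b M) n i)"
proof -
  note Mc = binary_mats_carrier[OF M]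
  have Pc: "M ^\<^sub>m n \<in> carrier_mat b b" for n using Mc by simp
  have entry: "(M ^\<^sub>m Suc n) $$ (i, j) = (\<Sum>k\<in>mat_succ b M i. (M ^\<^sub>m n) $$ (k, j))"
    if "i < b" "j < b" for n i j
  proof -
    have "(M ^\<^sub>m Suc n) $$ (i, j) = (\<Sum>k<b. M $$ (i, k) * (M ^\<^sub>m n) $$ (k, j))"
      unfolding pow_mat_Suc_left[OF Mc] using Mc Pc[of n] that
      by (simp add: scalar_prod_def atLeast0LessThan)
    also have "\<dots> = (\<Sum>k<b. if M $$ (i, k) = 1 then (M ^\<^sub>m n) $$ (k, j) else 0)"
      using binary_mats_index[OF M that(1)] by (intro sum.cong) auto
    also have "\<dots> = (\<Sum>k\<in>{k \<in> {..<b}. M $$ (i, k) = 1}. (M ^\<^sub>m n) $$ (k, j))"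
      by (rule sum.inter_filter[symmetric]) simp
    finally show ?thesis by (simp add: mat_succ_def)
  qed
  have sub: "k < b" if "k \<in> mat_succ b M i" for k i using that by (simp add: mat_succ_def)
  show "\<forall>j<b. 0 \<le> (M ^\<^sub>m n) $$ (i, j)" using i
  proof (induction n arbitrary: i)
    case 0
    then show ?case using Mc by simp
  next
    case (Suc n)
    show ?case using Suc sub by (auto simp: entry simp del: pow_mat.simps intro!: sum_nonneg)
  qed
  show "(\<Sum>j<b. (M ^\<^sub>m n) $$ (i, j)) = real (walk_count (mat_succ b M) n i)" using i
  proof (induction n arbitrary: i)
    case 0
    then show ?case using Mc by simp
  next
    case (Suc n)
    have "(\<Sum>j<b. (M ^\<^sub>m Suc n) $$ (i, j)) = (\<Sum>j<b. \<Sum>k\<in>mat_succ b M i. (M ^\<^sub>m n) $$ (k, j))"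
      using Suc.prems by (intro sum.cong) (simp_all add: entry del: pow_mat.simps)
    also have "\<dots> = (\<Sum>k\<in>mat_succ b M i. \<Sum>j<b. (M ^\<^sub>m n) $$ (k, j))" by (rule sum.swap)
    also have "\<dots> = (\<Sum>k\<in>mat_succ b M i. real (walk_count (mat_succ b M) n k))"
      by (intro sum.cong Suc.IH sub) auto
    finally show ?case by simp
  qed
qed

lemma entry_norm_pow:
  assumes "M \<in> binary_mats b"
  shows "entry_norm (M ^\<^sub>m n) = real (\<Sum>i<b. walk_count (mat_succ b M) n i)"
proof -
  have "entry_norm (M ^\<^sub>m n) = (\<Sum>i<b. \<Sum>j<b. \<bar>(M ^\<^sub>m n) $$ (i, j)\<bar>)"
    using binary_mats_carrier[OF assms] by (simp add: entry_norm_def)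
  also have "\<dots> = (\<Sum>i<b. \<Sum>j<b. (M ^\<^sub>m n) $$ (i, j))"
    using pow_mat_walks(1)[OF assms] by (intro sum.cong) auto
  also have "\<dots> = (\<Sum>i<b. real (walk_count (mat_succ b M) n i))"
    using pow_mat_walks(2)[OF assms] by (intro sum.cong) auto
  finally show ?thesis by simp
qed

text \<open>An edge into \<open>u\<close> makes column \<open>u\<close> nonzero, so the condition
  makes row \<open>u\<close> nonzero, which is an edge out of \<open>u\<close>.\<close>

lemma P1_graph_mat_succ:
  assumes "M \<in> binary_mats_P1 b"
  shows "P1_graph {..<b} (mat_succ b M)"
proof
  fix v u assume v: "v \<in> {..<b}" and u: "u \<in> mat_succ b M v"
  have M: "M \<in> binary_mats b" and P1: "cond_P1 b M"
    using assms by (auto simp: binary_mats_P1_def)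
  have Mc: "M \<in> carrier_mat b b" using binary_mats_carrier[OF M] .
  have u': "u < b" "M $$ (v, u) = 1" using u by (auto simp: mat_succ_def)
  have "col M u $ v = 1" using Mc u' v by simp
  then have "col M u \<noteq> 0\<^sub>v b" using v by auto
  then have "row M u \<noteq> 0\<^sub>v b" using P1 u' unfolding cond_P1_def by simp
  then obtain w where "w < b" "row M u $ w \<noteq> 0"
    using Mc by (metis carrier_matD(2) dim_vec eq_vecI index_row(2) index_zero_vec(1,2))
  then have "w \<in> mat_succ b M u"
    using Mc u' binary_mats_index[OF M, of u w] by (simp add: mat_succ_def)
  then show "mat_succ b M u \<noteq> {}" by blast
qed (auto simp: mat_succ_def)

section \<open>Extremal orders and the three block matrices\<close>

text \<open>All entries are 0 or 1, so a relabelling carries \<open>N\<close> to \<open>M\<close> as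
  soon as it matches the supports of the rows, and this is what an extremal order does.\<close>

lemma extremal_order_iff_matrix:
  assumes M: "M \<in> binary_mats b" and b: "2 \<le> b"
    and N: "N \<in> carrier_mat b b" "\<And>i j. i < b \<Longrightarrow> j < b \<Longrightarrow> N $$ (i, j) = (if j \<in> row_succ s i then 1 else 0)"
    and s: "s \<in> block_rows"
  shows "perm_equiv b M N \<longleftrightarrow> (\<exists>p. extremal_order (mat_succ b M) {..<b} s p)"
proof -
  have sub: "row_succ s i \<subseteq> {..<b}" if "i < b" for i
    using that b s by (auto simp: row_succ_def block_rows_def)
  have rows: "(\<forall>j<b. M $$ (p i, p j) = N $$ (i, j)) \<longleftrightarrow> mat_succ b M (p i) = p ` row_succ s i"
    if p: "bij_betw p {..<b} {..<b}" and i: "i < b" for p i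
  proof -
    have inj: "p j \<in> p ` row_succ s i \<longleftrightarrow> j \<in> row_succ s i" if "j < b" for j
      using p sub[OF i] that by (auto simp: bij_betw_def inj_on_def)
    have less: "p j < b" if "j < b" for j using p that by (auto simp: bij_betw_def)
    have "mat_succ b M (p i) = p ` row_succ s i \<longleftrightarrow>
        (\<forall>u<b. u \<in> mat_succ b M (p i) \<longleftrightarrow> u \<in> p ` row_succ s i)"
      using sub[OF i] less by (auto simp: mat_succ_def)
    also have "\<dots> \<longleftrightarrow> (\<forall>j<b. p j \<in> mat_succ b M (p i) \<longleftrightarrow> p j \<in> p ` row_succ s i)"
      using p less by (metis bij_betw_imp_surj_on imageE lessThan_iff)
    also have "\<dots> \<longleftrightarrow> (\<forall>j<b. M $$ (p i, p j) = 1 \<longleftrightarrow> j \<in> row_succ s i)"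
      by (simp add: mat_succ_def inj less cong: imp_cong)
    also have "\<dots> \<longleftrightarrow> (\<forall>j<b. M $$ (p i, p j) = N $$ (i, j))"
    proof -
      have "(M $$ (p i, p j) = 1 \<longleftrightarrow> j \<in> row_succ s i) \<longleftrightarrow> M $$ (p i, p j) = N $$ (i, j)"
        if "j < b" for j
        using binary_mats_index[OF M less[OF i] less[OF that]] N(2)[OF i that] by auto
      then show ?thesis by (simp cong: imp_cong)
    qed
    finally show ?thesis by simp
  qed
  have ord: "extremal_order (mat_succ b M) {..<b} s p \<longleftrightarrow> bij_betw p {..<b} {..<b} \<and>
      (\<forall>i<b. \<forall>j<b. M $$ (p i, p j) = N $$ (i, j))" for p
    using rows[of p] s b by (auto simp: extremal_order_def)
  show ?thesis unfolding perm_equiv_iff[OF M N(1)] ord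
  proof safe
    fix p assume "p permutes {..<b}" "\<forall>i<b. \<forall>j<b. M $$ (p i, p j) = N $$ (i, j)"
    then show "\<exists>p. bij_betw p {..<b} {..<b} \<and> (\<forall>i<b. \<forall>j<b. M $$ (p i, p j) = N $$ (i, j))"
      using permutes_imp_bij by blast
  next
    fix p assume p: "bij_betw p {..<b} {..<b}" "\<forall>i<b. \<forall>j<b. M $$ (p i, p j) = N $$ (i, j)"
    \<comment> \<open>\<open>permutes\<close> requires the identity outside the index set.\<close>
    let ?q = "\<lambda>i. if i < b then p i else i"
    have "bij_betw ?q {..<b} {..<b}" using p(1) by (subst bij_betw_cong[of _ _ p]) auto
    then have "?q permutes {..<b}" by (intro bij_imp_permutes) auto
    moreover have "\<forall>i<b. \<forall>j<b. M $$ (?q i, ?q j) = N $$ (i, j)" using p(2) by simp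
    ultimately show "\<exists>p. p permutes {..<b} \<and> (\<forall>i<b. \<forall>j<b. M $$ (p i, p j) = N $$ (i, j))"
      by blast
  qed
qed

lemma lower_block_carrier:
  "k \<le> b \<Longrightarrow> B \<in> carrier_mat k k \<Longrightarrow> lower_block b k B \<in> carrier_mat b b"
  by (auto simp: lower_block_def L_mat_def)

lemma J2_index: "i < 2 \<Longrightarrow> j < 2 \<Longrightarrow> J2 $$ (i, j) = (if j = 1 - i then 1 else 0)"
  by (auto simp: J2_def mat_of_rows_list_def less_2_cases_iff)

lemma J2_carrier: "J2 \<in> carrier_mat 2 2"
  by (rule carrier_matI) (simp_all add: J2_def mat_of_rows_list_def)

lemma lower_block_index:
  assumes "k \<le> b" "B \<in> carrier_mat k k" "i < b" "j < b"
  shows "lower_block b k B $$ (i, j) =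
    (if i < k then if j < k then B $$ (i, j) else 0 else if j < i then 1 else 0)"
  using assms by (auto simp: lower_block_def L_mat_def ones_mat_def)

text \<open>The 1 x 1 block fits the two-row description because row 1 of that matrix has its only 1
  in column 0, just like row 0.\<close>

lemma extremal_matrices_index:
  assumes "2 \<le> b" "i < b" "j < b"
  shows "lower_block b 1 (1\<^sub>m 1) $$ (i, j) = (if j \<in> row_succ (\<lambda>_. 0) i then 1 else 0)"
    and "lower_block b 2 (1\<^sub>m 2) $$ (i, j) = (if j \<in> row_succ id i then 1 else 0)"
    and "lower_block b 2 J2 $$ (i, j) = (if j \<in> row_succ (\<lambda>i. 1 - i) i then 1 else 0)"
  using assms lower_block_index[of 1 b "1\<^sub>m 1" i j] lower_block_index[of 2 b "1\<^sub>m 2" i j]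
    lower_block_index[OF assms(1) J2_carrier assms(2,3)] J2_index[of i j]
  by (simp_all add: row_succ_def) auto

section \<open>The supremum of the norms\<close>

lemma sup_walks_extremal:
  assumes M: "M \<in> binary_mats_P1 b" and b: "2 \<le> b"
  shows "(SUP n\<in>{n::nat. n > 0}. ereal (entry_norm (M ^\<^sub>m n))) = ereal (2 ^ (b - 1)) \<longleftrightarrow>
    (\<exists>s p. extremal_order (mat_succ b M) {..<b} s p)"
proof -
  let ?E = "mat_succ b M"
  let ?W = "\<lambda>n. \<Sum>i<b. walk_count ?E n i"
  have norm: "entry_norm (M ^\<^sub>m n) = real (?W n)" for n
    using M by (intro entry_norm_pow) (simp add: binary_mats_P1_def)
  interpret P1_graph "{..<b}" ?E by (rule P1_graph_mat_succ[OF M])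
  have pow: "ereal (2 ^ (b - 1)) = ereal (real (2 ^ (b - 1) :: nat))" by simp
  show ?thesis unfolding norm pow
  proof
    assume sup: "(SUP n\<in>{n::nat. n > 0}. ereal (real (?W n))) = ereal (real (2 ^ (b - 1) :: nat))"
    have le: "?W n \<le> 2 ^ (b - 1)" if "0 < n" for n
    proof -
      have "ereal (real (?W n)) \<le> (SUP n\<in>{n::nat. n > 0}. ereal (real (?W n)))"
        using that by (intro SUP_upper) simp
      then show ?thesis unfolding sup ereal_less_eq of_nat_le_iff .
    qed
    \<comment> \<open>The totals are integers, so one that exceeds the supremum minus 1 attains
      it.\<close>
    have "ereal (real (2 ^ (b - 1) :: nat) - 1) < (SUP n\<in>{n::nat. n > 0}. ereal (real (?W n)))"
      unfolding sup by simp
    then obtain n where n: "0 < n" "real (2 ^ (b - 1) :: nat) - 1 < real (?W n)"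
      unfolding less_SUP_iff by auto
    have ge: "2 ^ (b - 1) \<le> ?W n"
      using n(2) by linarith
    have eq: "?W n = 2 ^ (b - 1)" using ge le[OF n(1)] by (rule antisym[rotated])
    obtain k where k: "n = Suc k" using n(1) by (cases n) auto
    have mono: "walk_count ?E n i \<le> walk_count ?E (Suc n) i" if "i \<in> {..<b}" for i
      using walk_count_mono[OF that, of k] unfolding k .
    \<comment> \<open>The total cannot grow beyond the supremum, so it is the same at
      \<open>n\<close> and \<open>Suc n\<close>; by monotonicity every single count is then
      stable.\<close>
    have "?W n \<le> ?W (Suc n)" using mono by (rule sum_mono)
    then have "?W n = ?W (Suc n)" using le[of "Suc n"] eq by (metis antisym zero_less_Suc)
    then have "walk_count ?E n i = walk_count ?E (Suc n) i" if "i \<in> {..<b}" for i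
      by (rule sum_mono_inv) (use mono that in \<open>simp_all only: finite_lessThan\<close>)
    then interpret stable_walks "{..<b}" ?E n by unfold_locales (simp only:)
    have "2 * ?W n = 2 ^ card {..<b}" unfolding eq using b by (simp add: power_eq_if)
    then show "\<exists>s p. extremal_order ?E {..<b} s p"
      using extremal_bound[of "{..<b}"] closed_V by blast
  next
    assume "\<exists>s p. extremal_order ?E {..<b} s p"
    then obtain s p where s: "s \<in> block_rows" and p: "bij_betw p {..<b} {..<b}"
      and E: "\<And>i. i < b \<Longrightarrow> ?E (p i) = p ` row_succ s i"
      by (auto simp: extremal_order_def)
    have sub: "row_succ s i \<subseteq> {..<b}" if "i \<in> {..<b}" for i
      using that b s by (auto simp: row_succ_def block_rows_def)
    have W: "?W n = (\<Sum>i<b. walk_count (row_succ s) n i)" for n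
    proof -
      have "?W n = (\<Sum>i<b. walk_count ?E n (p i))"
        using sum.reindex_bij_betw[OF p, of "walk_count ?E n"] by simp
      also have "\<dots> = (\<Sum>i<b. walk_count (row_succ s) n i)"
        by (intro sum.cong walk_count_cong[where I = "{..<b}"])
          (use p sub E in \<open>auto simp: bij_betw_def\<close>)
      finally show ?thesis .
    qed
    have total: "(\<Sum>i<b. (2::nat) ^ (i - 1)) = 2 ^ (b - 1)" using b by (intro sum_power2_pred) simp
    have "?W n \<le> 2 ^ (b - 1)" for n
      unfolding W total[symmetric] by (intro sum_mono walk_count_row_succ s)
    \<comment> \<open>At length \<open>b\<close> all rows, having index below \<open>b\<close>, have
      reached their limits.\<close>
    moreover have "?W b = 2 ^ (b - 1)"
      unfolding W total[symmetric] by (intro sum.cong walk_count_row_succ s) auto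
    ultimately show "(SUP n\<in>{n::nat. n > 0}. ereal (real (?W n))) = ereal (real (2 ^ (b - 1) :: nat))"
      using b by (intro antisym SUP_least SUP_upper2[of b]) (simp_all only: ereal_less_eq of_nat_le_iff, auto)
  qed
qed

theorem theorem2:
  fixes b :: nat and M :: "real mat"
  assumes "b \<ge> 2" and "M \<in> binary_mats_P1 b"
  shows "((SUP n\<in>{n::nat. n > 0}. ereal (entry_norm (M ^\<^sub>m n))) = ereal (2 ^ (b - 1)) \<longleftrightarrow>
           perm_equiv b M (lower_block b 1 (1\<^sub>m 1)) \<or>
           perm_equiv b M (lower_block b 2 (1\<^sub>m 2)) \<or>
           perm_equiv b M (lower_block b 2 J2)) \<and>
         (b = 2 \<longrightarrow>
           lower_block b 1 (1\<^sub>m 1) = mat_of_rows_list 2 [[1, 0], [1, 0]] \<and>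
           lower_block b 2 (1\<^sub>m 2) = 1\<^sub>m 2 \<and>
           lower_block b 2 J2 = J2)"
proof (intro conjI impI)
  have M: "M \<in> binary_mats b" using assms(2) by (simp add: binary_mats_P1_def)
  note iff = extremal_order_iff_matrix[OF M assms(1) lower_block_carrier]
  have 1: "perm_equiv b M (lower_block b 1 (1\<^sub>m 1)) \<longleftrightarrow>
      (\<exists>p. extremal_order (mat_succ b M) {..<b} (\<lambda>_. 0) p)"
    by (rule iff) (use assms(1) extremal_matrices_index(1) in \<open>auto simp: block_rows_def\<close>)
  have 2: "perm_equiv b M (lower_block b 2 (1\<^sub>m 2)) \<longleftrightarrow>
      (\<exists>p. extremal_order (mat_succ b M) {..<b} id p)"
    by (rule iff) (use assms(1) extremal_matrices_index(2) in \<open>auto simp: block_rows_def\<close>)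
  have 3: "perm_equiv b M (lower_block b 2 J2) \<longleftrightarrow>
      (\<exists>p. extremal_order (mat_succ b M) {..<b} (\<lambda>i. 1 - i) p)"
    by (rule iff) (use assms(1) extremal_matrices_index(3) J2_carrier in \<open>auto simp: block_rows_def\<close>)
  \<comment> \<open>\<open>extremal_order\<close> confines \<open>s\<close> to the three elements of
    \<open>block_rows\<close>, one for each matrix.\<close>
  have "(\<exists>s p. extremal_order (mat_succ b M) {..<b} s p) \<longleftrightarrow>
      (\<exists>s\<in>block_rows. \<exists>p. extremal_order (mat_succ b M) {..<b} s p)"
    by (auto simp: extremal_order_def)
  then show "(SUP n\<in>{n::nat. n > 0}. ereal (entry_norm (M ^\<^sub>m n))) = ereal (2 ^ (b - 1)) \<longleftrightarrow>
      perm_equiv b M (lower_block b 1 (1\<^sub>m 1)) \<or>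
      perm_equiv b M (lower_block b 2 (1\<^sub>m 2)) \<or>
      perm_equiv b M (lower_block b 2 J2)"
    unfolding sup_walks_extremal[OF assms(2,1)] 1 2 3 by (simp add: block_rows_def)
next
  assume b: "b = 2"
  show "lower_block b 1 (1\<^sub>m 1) = mat_of_rows_list 2 [[1, 0], [1, 0]]"
    unfolding b by (rule eq_matI)
      (auto simp: lower_block_index less_2_cases_iff mat_of_rows_list_def lower_block_def
        L_mat_def ones_mat_def)
  show "lower_block b 2 (1\<^sub>m 2) = 1\<^sub>m 2"
    unfolding b by (rule eq_matI) (auto simp: lower_block_index lower_block_def L_mat_def)
  show "lower_block b 2 J2 = J2"
    unfolding b using J2_carrier
    by (intro eq_matI) (auto simp: lower_block_index lower_block_def L_mat_def)
qed

end
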